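(* If the non-autonomous system $(X,f_{1,\infty})$ has the strong specification property (SSP), then it is Devaney chaotic.
   Context: A non-autonomous (discrete) system $(X,f_{1,\infty})$ consists of a compact metric space $(X,d)$ and a sequence $f_{1,\infty}=(f_n)_{n\ge 1}$ of continuous surjective maps $f_n:X\to X$. Write $\mathbb{N}=\{1,2,\dots\}$, $f_1^0=\mathrm{id}$ and $f_1^n=f_n\circ\cdots\circ f_1$ for $n\ge1$. A point $z$ is periodic with period $p\in\mathbb{N}$ if $f_1^{pm}(z)=z$ for every $m\in\mathbb{N}$ ($p$ need not be minimal); it is periodic if it is periodic with some period. $(X,f_{1,\infty})$ has the strong specification property (SSP) if for every $\epsilon>0$ there is a positive integer $M(\epsilon)$ such that for every $s\in\mathbb{N}$, every choice of points $x_1,\dots,x_s\in X$, every sequence $a_1\le b_1<a_2\le b_2<\cdots<a_s\le b_s$ of non-negative integers with $a_j-b_{j-1}>M(\epsilon)$ for $2\le j\le s$, and every integer $p>M(\epsilon)+b_s-a_1$, there is a periodic point $z\in X$ with period $p$ such that $d(f_1^j(z),f_1^j(x_i))<\epsilon$ for all $a_i\le j\le b_i$, $1\le i\le s$. Devaney chaotic means: (1) topologically transitive: for every pair of non-empty open $U,V\subseteq X$ there is $n\in\mathbb{N}$ with $f_1^n(U)\cap V\ne\emptyset$; (2) the set of periodic points is dense in $X$; (3) sensitive dependence on initial conditions: there is $\delta>0$ such that for every $x\in X$ and every neighborhood $U$ of $x$ there are $y\in U$ and $n\in\mathbb{N}$ with $d(f_1^n(x),f_1^n(y))>\delta$.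
   Formalization: The space X is additionally assumed not to consist of a single point; on a one-point space SSP holds trivially but sensitive dependence on initial conditions fails, since all distances are 0. *)

theory Defs
  imports "HOL-Analysis.Analysis"
begin

primrec orbit_map :: "(nat \<Rightarrow> 'a \<Rightarrow> 'a) \<Rightarrow> nat \<Rightarrow> 'a \<Rightarrow> 'a" where
  "orbit_map f 0 = id"
| "orbit_map f (Suc n) = f (Suc n) \<circ> orbit_map f n"

text \<open>The sequence is indexed from 1; the value of \<open>f 0\<close> is irrelevant.\<close>

locale nonautonomous_system = Metric_space X d
  for X :: "'a set" and d :: "'a \<Rightarrow> 'a \<Rightarrow> real" +
  fixes f :: "nat \<Rightarrow> 'a \<Rightarrow> 'a"
  assumes compact: "compact_space mtopology"
    and continuous: "n \<ge> 1 \<Longrightarrow> continuous_map mtopology mtopology (f n)"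
    and surjective: "n \<ge> 1 \<Longrightarrow> f n ` X = X"
begin

definition periodic_with_period :: "'a \<Rightarrow> nat \<Rightarrow> bool" where
  "periodic_with_period z p \<longleftrightarrow>
     z \<in> X \<and> p \<ge> 1 \<and> (\<forall>m\<ge>1. orbit_map f (p * m) z = z)"

definition periodic :: "'a \<Rightarrow> bool" where
  "periodic z \<longleftrightarrow> (\<exists>p. periodic_with_period z p)"

text \<open>
  The subtractions on \<^typ>\<open>nat\<close> below do not truncate, since
  \<open>b (j - 1) < a j\<close> and \<open>a 1 \<le> b s\<close>.
\<close>

definition strong_specification :: bool where
  "strong_specification \<longleftrightarrow>
     (\<forall>\<epsilon>>0. \<exists>M::nat. M \<ge> 1 \<and>
       (\<forall>s\<ge>1. \<forall>(x::nat \<Rightarrow> 'a) (a::nat \<Rightarrow> nat) (b::nat \<Rightarrow> nat) (p::nat).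
          (\<forall>i\<in>{1..s}. x i \<in> X) \<and>
          (\<forall>i\<in>{1..s}. a i \<le> b i) \<and>
          (\<forall>j\<in>{2..s}. b (j - 1) < a j) \<and>
          (\<forall>j\<in>{2..s}. a j - b (j - 1) > M) \<and>
          p > M + (b s - a 1) \<longrightarrow>
          (\<exists>z. periodic_with_period z p \<and>
             (\<forall>i\<in>{1..s}. \<forall>j\<in>{a i..b i}.
                d (orbit_map f j z) (orbit_map f j (x i)) < \<epsilon>))))"

definition topologically_transitive :: bool where
  "topologically_transitive \<longleftrightarrow>
     (\<forall>U V. openin mtopology U \<and> openin mtopology V \<and> U \<noteq> {} \<and> V \<noteq> {} \<longrightarrow>
        (\<exists>n\<ge>1. orbit_map f n ` U \<inter> V \<noteq> {}))"

definition sensitive :: bool where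
  "sensitive \<longleftrightarrow>
     (\<exists>\<delta>>0. \<forall>x\<in>X. \<forall>U\<subseteq>X. (\<exists>W. openin mtopology W \<and> x \<in> W \<and> W \<subseteq> U) \<longrightarrow>
        (\<exists>y\<in>U. \<exists>n\<ge>1. d (orbit_map f n x) (orbit_map f n y) > \<delta>))"

definition Devaney_chaotic :: bool where
  "Devaney_chaotic \<longleftrightarrow>
     topologically_transitive \<and>
     mtopology closure_of {z. periodic z} = X \<and>
     sensitive"

end

end

theory Submission
  imports Defs
begin

text \<open>
  Specification with the two segments \<open>{0}\<close> and \<open>{N}\<close>, together with surjectivity of \<open>f\<^sub>1\<^sup>N\<close>, yields
  a periodic point near any prescribed \<open>x\<close> whose image at time \<open>N\<close> is near any prescribed \<open>v\<close>,
  where \<open>N\<close> depends only on the accuracy. This gives transitivity and density of periodic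
  points. Since of two distinct points \<open>p\<close>, \<open>q\<close> at least one is at distance \<open>\<ge> d p q / 2\<close>
  from the image of \<open>x\<close> at time \<open>N\<close>, it also gives sensitivity.
\<close>

context nonautonomous_system
begin

lemma orbit_map_image: "orbit_map f n ` X = X"
proof (induction n)
  case (Suc n)
  then show ?case using surjective[of "Suc n"]
    by (metis image_comp le_add1 orbit_map.simps(2) plus_1_eq_Suc)
qed simp

lemma orbit_map_in: "x \<in> X \<Longrightarrow> orbit_map f n x \<in> X"
  using orbit_map_image by blast

text \<open>\<open>N\<close> is one more than the specification constant for
  \<open>\<epsilon>\<close>, so the times 0 and \<open>N\<close> are far enough apart whatever
  \<open>x\<close> and \<open>v\<close> are. The order of quantifiers matters: for sensitivity the
  target \<open>v\<close> is chosen only once \<open>N\<close> is known.\<close>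

lemma strong_specification_steer:
  assumes "strong_specification" "\<epsilon> > 0"
  shows "\<exists>N\<ge>1. \<forall>x\<in>X. \<forall>v\<in>X. \<exists>z\<in>X. periodic z \<and> d z x < \<epsilon> \<and> d (orbit_map f N z) v < \<epsilon>"
proof -
  from assms(1)[unfolded strong_specification_def, rule_format, OF assms(2)]
  obtain M where M: "\<forall>s\<ge>1::nat. \<forall>x (a::nat \<Rightarrow> nat) b p.
      (\<forall>i\<in>{1..s}. x i \<in> X) \<and> (\<forall>i\<in>{1..s}. a i \<le> b i) \<and>
      (\<forall>j\<in>{2..s}. b (j - 1) < a j) \<and> (\<forall>j\<in>{2..s}. a j - b (j - 1) > M) \<and> p > M + (b s - a 1) \<longrightarrow>
      (\<exists>z. periodic_with_period z p \<and>
        (\<forall>i\<in>{1..s}. \<forall>j\<in>{a i..b i}. d (orbit_map f j z) (orbit_map f j (x i)) < \<epsilon>))"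
    by (elim exE conjE)
  have "\<exists>z\<in>X. periodic z \<and> d z x < \<epsilon> \<and> d (orbit_map f (Suc M) z) v < \<epsilon>"
    if xv: "x \<in> X" "v \<in> X" for x v
  proof -
    \<comment> \<open>Specification shadows orbits, so the target \<open>v\<close> is encoded by a
      point \<open>w\<close> whose orbit is at \<open>v\<close> at time
      \<open>Suc M\<close>.\<close>
    obtain w where w: "w \<in> X" "orbit_map f (Suc M) w = v"
      using xv(2) orbit_map_image[of "Suc M"] by (metis imageE)
    have s2: "{1..2} = {1, 2::nat}" "{2..2} = {2::nat}" by auto
    define xs where "xs i = (if i = 1 then x else w)" for i :: nat
    \<comment> \<open>\<open>t\<close> gives both the left and the right endpoints, so each segment
      is a single time; \<open>Suc M\<close> is the smallest gap exceeding \<open>M\<close>.\<close>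
    define t where "t i = (if i = 1 then 0 else Suc M)" for i :: nat
    have vals: "xs 1 = x" "xs 2 = w" "t 1 = 0" "t (Suc 0) = 0" "t 2 = Suc M"
      by (simp_all add: xs_def t_def)
    \<comment> \<open>The period is the least integer above \<open>M + (Suc M - 0)\<close>.\<close>
    obtain z where z: "periodic_with_period z (M + Suc (Suc M))"
      "\<forall>i\<in>{1..2}. \<forall>j\<in>{t i..t i}. d (orbit_map f j z) (orbit_map f j (xs i)) < \<epsilon>"
      using M[THEN spec, of 2, THEN mp, THEN spec, of xs, THEN spec, of t, THEN spec, of t,
          THEN spec, of "M + Suc (Suc M)"] xv w(1)
      by (auto simp: s2 vals simp del: orbit_map.simps(2) One_nat_def)
    then have "d z x < \<epsilon>" "d (orbit_map f (Suc M) z) v < \<epsilon>"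
      using w(2) by (auto simp: s2 vals simp del: orbit_map.simps(2) One_nat_def)
    with z(1) show ?thesis unfolding periodic_def periodic_with_period_def by blast
  qed
  then show ?thesis by (intro exI[of _ "Suc M"]) simp
qed

lemma strong_specification_imp_transitive:
  assumes "strong_specification"
  shows "topologically_transitive"
  unfolding topologically_transitive_def
proof (intro allI impI, elim conjE)
  fix U V assume U: "openin mtopology U" "U \<noteq> {}" and V: "openin mtopology V" "V \<noteq> {}"
  then obtain u v where uv: "u \<in> U" "v \<in> V" by blast
  obtain r where r: "r > 0" "mball u r \<subseteq> U" using uv U unfolding openin_mtopology by blast
  obtain s where s: "s > 0" "mball v s \<subseteq> V" using uv V unfolding openin_mtopology by blast
  have X: "u \<in> X" "v \<in> X" using uv U V unfolding openin_mtopology by auto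
  \<comment> \<open>The bound \<open>r\<close> keeps the start in \<open>U\<close>, and
    \<open>s\<close> keeps the image at time \<open>N\<close> in \<open>V\<close>.\<close>
  have pos: "min r s > 0" using r(1) s(1) by simp
  obtain N where N: "N \<ge> 1"
    "\<forall>x\<in>X. \<forall>v\<in>X. \<exists>z\<in>X. periodic z \<and> d z x < min r s \<and> d (orbit_map f N z) v < min r s"
    using strong_specification_steer[OF assms pos] by blast
  obtain z where z: "z \<in> X" "d z u < min r s" "d (orbit_map f N z) v < min r s"
    using N(2) X by blast
  then have "z \<in> U" "orbit_map f N z \<in> V"
    using r(2) s(2) X orbit_map_in by (auto simp: subset_iff commute)
  then show "\<exists>n\<ge>1. orbit_map f n ` U \<inter> V \<noteq> {}" using N(1) by blast
qed

lemma strong_specification_imp_dense_periodic: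
  assumes "strong_specification"
  shows "mtopology closure_of {z. periodic z} = X"
proof -
  have "x \<in> mtopology closure_of {z. periodic z}" if x: "x \<in> X" for x
    unfolding metric_closure_of
  proof (clarsimp simp: x)
    fix r :: real assume "r > 0"
    \<comment> \<open>Closeness at time 0 gives the claim; \<open>x\<close> itself can be the target
      at time \<open>N\<close>.\<close>
    then obtain z where "periodic z" "d z x < r"
      using strong_specification_steer[OF assms] x by meson
    then show "\<exists>y. periodic y \<and> y \<in> X \<and> d x y < r"
      by (auto simp: commute periodic_def periodic_with_period_def)
  qed
  then show ?thesis using closure_of_subset_topspace[of mtopology] by auto
qed

text \<open>On a one-point space no two orbits separate, so that case is excluded; on the empty
  space sensitivity is vacuous.\<close>

lemma strong_specification_imp_sensitive:
  assumes spec: "strong_specification" and "\<nexists>x. X = {x}"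
  shows "sensitive"
proof (cases "X = {}")
  case True
  show ?thesis unfolding sensitive_def by (rule exI[of _ 1]) (simp add: True)
next
  case False
  then obtain p q where pq: "p \<in> X" "q \<in> X" "p \<noteq> q" using assms(2) by blast
  \<comment> \<open>A quarter rather than a half: steering may miss \<open>v\<close> by almost
    \<open>\<delta>\<close>, and a separation above \<open>\<delta>\<close> must remain out of
    \<open>2 * \<delta>\<close>.\<close>
  define \<delta> where "\<delta> = d p q / 4"
  have \<delta>: "\<delta> > 0" using pq mdist_pos_less by (simp add: \<delta>_def)
  show ?thesis
    unfolding sensitive_def
  proof (intro exI conjI ballI allI impI; (elim exE conjE)?)
    show "\<delta> > 0" by (fact \<delta>)
    fix x U W assume x: "x \<in> X" and W: "openin mtopology W" "x \<in> W" "W \<subseteq> U"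
    then obtain r where r: "r > 0" "mball x r \<subseteq> U" unfolding openin_mtopology by blast
    \<comment> \<open>\<open>N\<close> may vary with \<open>r\<close>, hence with the neighbourhood,
      while \<open>\<delta>\<close> comes from \<open>p\<close> and \<open>q\<close> alone and so is
      uniform in \<open>x\<close> and \<open>U\<close>.\<close>
    have pos: "min r \<delta> > 0" using r(1) \<delta> by simp
    obtain N where N: "N \<ge> 1"
      "\<forall>x\<in>X. \<forall>v\<in>X. \<exists>z\<in>X. periodic z \<and> d z x < min r \<delta> \<and> d (orbit_map f N z) v < min r \<delta>"
      using strong_specification_steer[OF spec pos] by blast
    have xN: "orbit_map f N x \<in> X" using x by (rule orbit_map_in)
    have "d p q \<le> d (orbit_map f N x) p + d (orbit_map f N x) q"
      using triangle[OF pq(1) xN pq(2)] by (simp add: commute)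
    then have "d (orbit_map f N x) p \<ge> 2 * \<delta> \<or> d (orbit_map f N x) q \<ge> 2 * \<delta>"
      unfolding \<delta>_def by linarith
    then obtain v where v: "v \<in> X" "d (orbit_map f N x) v \<ge> 2 * \<delta>" using pq by blast
    obtain y where y: "y \<in> X" "d y x < min r \<delta>" "d (orbit_map f N y) v < min r \<delta>"
      using N(2) x v(1) by blast
    have "y \<in> U" using y r(2) x by (auto simp: subset_iff commute)
    moreover have "d (orbit_map f N x) (orbit_map f N y) > \<delta>"
      using triangle[OF xN orbit_map_in[OF y(1), of N] v(1)] v(2) y(3) by linarith
    ultimately show "\<exists>y\<in>U. \<exists>n\<ge>1. d (orbit_map f n x) (orbit_map f n y) > \<delta>"
      using N(1) by blast
  qed
qed

end

theorem corollary4p4: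
  fixes X :: "'a set" and d :: "'a \<Rightarrow> 'a \<Rightarrow> real" and f :: "nat \<Rightarrow> 'a \<Rightarrow> 'a"
  assumes "nonautonomous_system X d f"
    and "\<nexists>x. X = {x}"
    and "nonautonomous_system.strong_specification X d f"
  shows "nonautonomous_system.Devaney_chaotic X d f"
proof -
  interpret nonautonomous_system X d f by (fact assms(1))
  show ?thesis
    unfolding Devaney_chaotic_def
    using assms(2,3) strong_specification_imp_transitive strong_specification_imp_dense_periodic
      strong_specification_imp_sensitive by blast
qed

end
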